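(* Consider one macro time step $[T^N,T^{N+1}]$ of the two-subdomain heterogeneous EMT-TS restricted additive Schwarz (RAS) iteration described in the context, with $\mathbb{A}_{1}$ and $\mathbb{H}_{2}$ invertible, and arbitrary initial iterates $(w_1^{(0)},\mathbb{W}_2^{(0)})$. Let $y^{(k)}=R_\Gamma\begin{pmatrix}w_1^{(k)}\\ \mathbb{W}_2^{(k)}\end{pmatrix}\in\mathbb{R}^{n_\Gamma}$ be the interface values of the $k$-th iterate, let $P_\Gamma=R_\Gamma PR_\Gamma^T$ be the interface error operator, and let $y^{(\infty)}=R_\Gamma\begin{pmatrix}w_1^{(\infty)}\\ \mathbb{W}_2^{(\infty)}\end{pmatrix}$ be the interface values of the true solution, i.e. of the fixed point $(w_1^{(\infty)},\mathbb{W}_2^{(\infty)})$ of the iteration. If $1$ is not an eigenvalue of $P_\Gamma$, then the true interface values are obtained from any two consecutive iterates, whether or not the iteration converges, by the Aitken formula $$y^{(\infty)}=(I_{n_\Gamma}-P_\Gamma)^{-1}\big(y^{(k)}-P_\Gamma\,y^{(k-1)}\big),\qquad k\ge1 .$$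
   Context: Setting. A linear DAE (electrical circuit) has unknowns indexed by a finite set $W$, covered by two (possibly overlapping) subsets $W_1,W_2$ with $W_1\cup W_2=W$. $W_{i,e}$ is the set of unknowns outside $W_i$ that are neighbours of $W_i$ in the graph of the system matrix; thus $W_{1,e}\subset W_2$ and $W_{2,e}\subset W_1$. Put $n_i=|W_i|$, $n_{i,e}=|W_{i,e}|$. Subdomain 1 is modelled by dynamic phasors (TS): each unknown is represented by $2K$ real numbers, the real and imaginary parts of $K$ complex harmonic coefficients (harmonics in a set $I$, $|I|=K$). Subdomain 2 is modelled by instantaneous values (EMT). The TS (macro) time step is $\Delta t_{ts}=T^{N+1}-T^N=m\,\Delta t_{emt}$ with $m$ a positive integer; the EMT times are $t^{n+1},\dots,t^{n+m}$ with $t^n=T^N$. $\omega_0$ is the base pulsation, $T_0=2\pi/\omega_0=\tilde m\,\Delta t_{emt}$ the period, with $\tilde m\ge m$ an integer. $j$ is the imaginary unit. Iteration. $w_1^{(k)}\in\mathbb{R}^{2Kn_1}$ is the TS solution at $T^{N+1}$; $\mathbb{W}_2^{(k)}\in\mathbb{R}^{mn_2}$ stacks the EMT solutions at $t^{n+1},\dots,t^{n+m}$; for $k\ge0$, $$w_1^{(k+1)}=\mathbb{A}_1^{-1}\big(b_1-\mathbb{E}_{1}Z_{1e}^{(k)}\big),\qquad \mathbb{W}_2^{(k+1)}=\mathbb{H}_2^{-1}\big(\mathbb{E}_{2}\,\mathbb{T}[R_{2,e}w_1^{(k)}]+g_2\big).$$ All data from previous macro steps are fixed during the iteration. A fixed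 point is a pair reproduced by the iteration (the solution of the coupled system). Restrictions. $R_{2,e}\in\mathbb{R}^{2Kn_{2,e}\times 2Kn_1}$ extracts from a TS vector on $W_1$ the coefficients of the unknowns in $W_{2,e}$. $R_{1,e}\in\mathbb{R}^{n_{1,e}\times n_2}$ extracts from an EMT vector on $W_2$ the components in $W_{1,e}$; $I_m\otimes R_{1,e}$ does this at each of the $m$ EMT steps. (The rows of these matrices are distinct standard basis vectors.) The interface restriction is $$R_\Gamma=\begin{pmatrix}R_{2,e}&0\\0&I_m\otimes R_{1,e}\end{pmatrix}\in\mathbb{R}^{n_\Gamma\times(2Kn_1+mn_2)},\qquad n_\Gamma=2Kn_{2,e}+mn_{1,e}.$$ TS side. $\mathbb{A}_1$ is the square matrix of the discretized TS subsystem, of size $2Kn_1$; $b_1$ is a fixed vector. $\mathbb{E}_1=\mathbb{E}^{ts}_{1}\mathbb{T}^{emt}_{ts}\in\mathbb{R}^{2Kn_1\times \tilde m n_{1,e}}$, where $\mathbb{E}^{ts}_1\in\mathbb{R}^{2Kn_1\times 2Kn_{1,e}}$ is a fixed coupling matrix and $\mathbb{T}^{emt}_{ts}:\mathbb{R}^{\tilde m n_{1,e}}\to\mathbb{R}^{2Kn_{1,e}}$ is the linear EMT-to-TS translation: for each interface unknown, a discrete Fourier transform of its one-period history keeping the $K$ selected harmonics, multiplication by a fixed phase-compensation factor for each harmonic, then separation into real and imaginary parts. The history $Z_{1e}^{(k)}\in\mathbb{R}^{\tilde m n_{1,e}}$ consists of $\tilde m-m$ blocks of size $n_{1,e}$ that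 are already-converged values at earlier EMT times (independent of $k$) followed by the $m$ active blocks $(I_m\otimes R_{1,e})\mathbb{W}_2^{(k)}$. $\tilde R_{hist}^{0T}:\mathbb{R}^{mn_{1,e}}\to\mathbb{R}^{\tilde m n_{1,e}}$ places its argument in the last $m$ blocks and fills the first $\tilde m-m$ blocks with zeros. EMT side. $\mathbb{H}_2\in\mathbb{R}^{mn_2\times mn_2}$ is block lower bidiagonal with diagonal blocks $\mathbb{A}_{2}\in\mathbb{R}^{n_2\times n_2}$ and subdiagonal blocks $-\mathbb{I}_{2}$; $\mathbb{E}_2\in\mathbb{R}^{mn_2\times mn_{2,e}}$ is block lower bidiagonal with diagonal blocks $E_{2}\in\mathbb{R}^{n_2\times n_{2,e}}$ and subdiagonal blocks $-\mathbb{I}_{2,e}$ (all given matrices); $g_2$ is a fixed vector. The TS-to-EMT translation $\mathbb{T}[\cdot]:\mathbb{R}^{2Kn_{2,e}}\to\mathbb{R}^{mn_{2,e}}$ is the affine map whose block at time $t^l$ ($n+1\le l\le n+m$) is, for $v$ with complex harmonic coefficients $(v_q)_{q\in I}$, $$\mathrm{Re}\sum_{q\in I}\big((1-\theta_l)\,v^N_q+\theta_l\,v_q\big)e^{jq\omega_0t^l},$$ where $(v_q^N)_{q\in I}$ are the fixed (converged) interface coefficients at $T^N$ and $\theta_l\in[0,1]$ is the smoothing weight: for a smoothing length $\alpha\in\{2,\dots,m\}$, $\theta_l=\frac{l-n-1}{\alpha-1}$ if $l\le n+\alpha$ and $\theta_l=1$ otherwise ($\theta_l=1$ for all $l$ if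 no smoothing). $\mathbb{T}_{lin}$ is its linear part, the real matrix with block at $t^l$ given by $v\mapsto \mathrm{Re}\sum_{q\in I}\theta_l v_qe^{jq\omega_0t^l}$. Error operator. $$P=\begin{pmatrix}0 & -\mathbb{A}_1^{-1}\mathbb{E}_{1}\tilde R_{hist}^{0T}(I_m\otimes R_{1,e})\\ \mathbb{H}_2^{-1}\mathbb{E}_{2}\,\mathbb{T}_{lin}R_{2,e} & 0\end{pmatrix},\qquad P_\Gamma=R_\Gamma PR_\Gamma^T\in\mathbb{R}^{n_\Gamma\times n_\Gamma}.$$ *)

theory Defs
  imports Complex_Main
    "Jordan_Normal_Form.Gauss_Jordan_Elimination"
    "Jordan_Normal_Form.Char_Poly"
begin

definition mat_inv :: "'a :: field mat \<Rightarrow> 'a mat" where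
  "mat_inv A = the (mat_inverse A)"

definition kronecker :: "'a :: semiring_0 mat \<Rightarrow> 'a mat \<Rightarrow> 'a mat" (infixl \<open>\<otimes>\<^sub>K\<close> 75) where
  "A \<otimes>\<^sub>K B = mat (dim_row A * dim_row B) (dim_col A * dim_col B)
     (\<lambda>(i, j). A $$ (i div dim_row B, j div dim_col B) * B $$ (i mod dim_row B, j mod dim_col B))"

definition block_bidiag :: "nat \<Rightarrow> 'a :: zero mat \<Rightarrow> 'a mat \<Rightarrow> 'a mat" where
  "block_bidiag m D L = mat (m * dim_row D) (m * dim_col D)
     (\<lambda>(i, j). let p = i div dim_row D; q = j div dim_col D;
                   r = i mod dim_row D; s = j mod dim_col D
               in if p = q then D $$ (r, s) else if p = q + 1 then L $$ (r, s) else 0)"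

text \<open>The matrix, in the canonical bases, of a map that is meant to be linear.\<close>

definition mat_of_map :: "nat \<Rightarrow> nat \<Rightarrow> ('a :: zero_neq_one vec \<Rightarrow> 'a vec) \<Rightarrow> 'a mat" where
  "mat_of_map nr nc f = mat nr nc (\<lambda>(i, j). f (unit_vec nc j) $ i)"

text \<open>Row \<open>a\<close> is the standard basis row selecting the unknown \<open>us ! a\<close> among \<open>vs\<close>.\<close>

definition selection :: "'w list \<Rightarrow> 'w list \<Rightarrow> real mat" where
  "selection us vs = mat (length us) (length vs) (\<lambda>(a, b). if us ! a = vs ! b then 1 else 0)"

text \<open>
  The data of one macro time step, which starts at the time \<open>tN\<close>.

  \<^item> \<open>Sys i j\<close> is the entry of the DAE system matrix in row \<open>i\<close> and column \<open>j\<close>.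
  \<^item> \<open>m\<close> and \<open>mt\<close> are the numbers of EMT steps in a macro step and in a period.
  \<^item> \<open>alpha\<close> is the smoothing length; \<open>None\<close> means that there is no smoothing.
  \<^item> \<open>phi q\<close> is the factor applied to the DFT coefficient of harmonic \<open>q\<close>. It is an arbitrary
    complex number, so that it also contains the normalisation of the DFT (such as
    \<open>1 / mt\<close> or \<open>2 / mt\<close>) and the phase due to the choice of time origin.
  \<^item> \<open>zhist\<close> contains the converged history, \<open>vN\<close> the converged coefficients at \<open>tN\<close>
    of the interface unknowns of subdomain 2.
  \<^item> \<open>Isub2\<close> and \<open>Isub2e\<close> enter the bidiagonal matrices with a minus sign.

  Unknowns are listed in increasing order. A TS vector is ordered by unknown, then harmonic
  (increasing), then real and imaginary part; a stack of EMT vectors is ordered by time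
  step, then unknown.
\<close>

record 'w ras_data =
  W :: "'w set"
  W1 :: "'w set"
  W2 :: "'w set"
  Sys :: "'w \<Rightarrow> 'w \<Rightarrow> real"
  harms :: "int set"
  m :: nat
  mt :: nat
  dt_emt :: real
  tN :: real
  omega0 :: real
  alpha :: "nat option"
  phi :: "int \<Rightarrow> complex"
  A1 :: "real mat"
  b1 :: "real vec"
  E1ts :: "real mat"
  zhist :: "real vec"
  A2 :: "real mat"
  Isub2 :: "real mat"
  E2 :: "real mat"
  Isub2e :: "real mat"
  g2 :: "real vec"
  vN :: "real vec"

text \<open>
  Adjacency is read off the rows of the system matrix; the undirected graph is the case of a
  matrix with symmetric pattern. Only the pattern of \<open>Sys\<close> is ever used.
\<close>

definition exterior :: "'w ras_data \<Rightarrow> 'w set \<Rightarrow> 'w set" where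
  "exterior D V = {j \<in> W D - V. \<exists>i\<in>V. Sys D i j \<noteq> 0}"

definition W1e :: "'w ras_data \<Rightarrow> 'w set" where "W1e D = exterior D (W1 D)"
definition W2e :: "'w ras_data \<Rightarrow> 'w set" where "W2e D = exterior D (W2 D)"

definition K :: "'w ras_data \<Rightarrow> nat" where "K D = card (harms D)"
definition n1 :: "'w ras_data \<Rightarrow> nat" where "n1 D = card (W1 D)"
definition n2 :: "'w ras_data \<Rightarrow> nat" where "n2 D = card (W2 D)"
definition n1e :: "'w ras_data \<Rightarrow> nat" where "n1e D = card (W1e D)"
definition n2e :: "'w ras_data \<Rightarrow> nat" where "n2e D = card (W2e D)"
definition nGamma :: "'w ras_data \<Rightarrow> nat" where
  "nGamma D = 2 * K D * n2e D + m D * n1e D"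

definition ras_setting :: "'w ras_data \<Rightarrow> bool" where
  "ras_setting D \<longleftrightarrow>
     finite (W D) \<and> W1 D \<union> W2 D = W D \<and> finite (harms D) \<and>
     1 \<le> m D \<and> m D \<le> mt D \<and> 0 < dt_emt D \<and> 0 < omega0 D \<and>
     2 * pi / omega0 D = real (mt D) * dt_emt D \<and>
     (case alpha D of None \<Rightarrow> True | Some a \<Rightarrow> 2 \<le> a \<and> a \<le> m D) \<and>
     A1 D \<in> carrier_mat (2 * K D * n1 D) (2 * K D * n1 D) \<and>
     b1 D \<in> carrier_vec (2 * K D * n1 D) \<and>
     E1ts D \<in> carrier_mat (2 * K D * n1 D) (2 * K D * n1e D) \<and>
     zhist D \<in> carrier_vec ((mt D - m D) * n1e D) \<and>
     A2 D \<in> carrier_mat (n2 D) (n2 D) \<and>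
     Isub2 D \<in> carrier_mat (n2 D) (n2 D) \<and>
     E2 D \<in> carrier_mat (n2 D) (n2e D) \<and>
     Isub2e D \<in> carrier_mat (n2 D) (n2e D) \<and>
     g2 D \<in> carrier_vec (m D * n2 D) \<and>
     vN D \<in> carrier_vec (2 * K D * n2e D)"

text \<open>The \<open>p\<close>-th selected harmonic, and the complex coefficient stored for it in a TS vector.\<close>

definition harm :: "'w ras_data \<Rightarrow> nat \<Rightarrow> int" where
  "harm D p = sorted_list_of_set (harms D) ! p"

definition harm_coeff :: "'w ras_data \<Rightarrow> real vec \<Rightarrow> nat \<Rightarrow> nat \<Rightarrow> complex" where
  "harm_coeff D v i p = Complex (v $ (2 * K D * i + 2 * p)) (v $ (2 * K D * i + 2 * p + 1))"

subsection \<open>Restrictions\<close>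

definition R2e :: "'w :: linorder ras_data \<Rightarrow> real mat" where
  "R2e D = selection (sorted_list_of_set (W2e D)) (sorted_list_of_set (W1 D)) \<otimes>\<^sub>K 1\<^sub>m (2 * K D)"

definition R1e :: "'w :: linorder ras_data \<Rightarrow> real mat" where
  "R1e D = selection (sorted_list_of_set (W1e D)) (sorted_list_of_set (W2 D))"

definition RGamma :: "'w :: linorder ras_data \<Rightarrow> real mat" where
  "RGamma D = four_block_mat
     (R2e D) (0\<^sub>m (2 * K D * n2e D) (m D * n2 D))
     (0\<^sub>m (m D * n1e D) (2 * K D * n1 D)) (1\<^sub>m (m D) \<otimes>\<^sub>K R1e D)"

subsection \<open>TS side\<close>

definition emt_to_ts :: "'w ras_data \<Rightarrow> real vec \<Rightarrow> real vec" where
  "emt_to_ts D z = vec (2 * K D * n1e D) (\<lambda>r.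
     let i = r div (2 * K D); p = (r mod (2 * K D)) div 2; q = harm D p;
         c = phi D q * (\<Sum>s<mt D. of_real (z $ (s * n1e D + i)) *
                         exp (- (2 * of_real pi * \<i> * of_int q * of_nat s / of_nat (mt D))))
     in if even r then Re c else Im c)"

definition T_emt_ts :: "'w ras_data \<Rightarrow> real mat" where
  "T_emt_ts D = mat_of_map (2 * K D * n1e D) (mt D * n1e D) (emt_to_ts D)"

definition E1 :: "'w ras_data \<Rightarrow> real mat" where
  "E1 D = E1ts D * T_emt_ts D"

definition Z1e :: "'w :: linorder ras_data \<Rightarrow> real vec \<Rightarrow> real vec" where
  "Z1e D u2 = zhist D @\<^sub>v ((1\<^sub>m (m D) \<otimes>\<^sub>K R1e D) *\<^sub>v u2)"

definition Rhist0T :: "'w ras_data \<Rightarrow> real mat" where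
  "Rhist0T D = 0\<^sub>m ((mt D - m D) * n1e D) (m D * n1e D) @\<^sub>r 1\<^sub>m (m D * n1e D)"

subsection \<open>EMT side\<close>

definition H2 :: "'w ras_data \<Rightarrow> real mat" where
  "H2 D = block_bidiag (m D) (A2 D) (- Isub2 D)"

definition E2stack :: "'w ras_data \<Rightarrow> real mat" where
  "E2stack D = block_bidiag (m D) (E2 D) (- Isub2e D)"

text \<open>
  The EMT steps of the macro step are numbered by \<open>s = 1, \<dots>, m\<close>: the step \<open>s\<close> is at
  the time \<open>t\<^sup>l\<close> with \<open>l = n + s\<close>.
\<close>

definition emt_time :: "'w ras_data \<Rightarrow> nat \<Rightarrow> real" where
  "emt_time D s = tN D + real s * dt_emt D"

definition theta :: "'w ras_data \<Rightarrow> nat \<Rightarrow> real" where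
  "theta D s = (case alpha D of None \<Rightarrow> 1
     | Some a \<Rightarrow> if s \<le> a then (real s - 1) / (real a - 1) else 1)"

definition ts_to_emt :: "'w ras_data \<Rightarrow> real vec \<Rightarrow> real vec" where
  "ts_to_emt D v = vec (m D * n2e D) (\<lambda>r.
     let s = r div n2e D + 1; i = r mod n2e D in
     Re (\<Sum>p<K D. (of_real (1 - theta D s) * harm_coeff D (vN D) i p
                     + of_real (theta D s) * harm_coeff D v i p)
                    * exp (\<i> * of_int (harm D p) * of_real (omega0 D * emt_time D s))))"

definition T_lin :: "'w ras_data \<Rightarrow> real mat" where
  "T_lin D = mat_of_map (m D * n2e D) (2 * K D * n2e D) (\<lambda>v. vec (m D * n2e D) (\<lambda>r.
     let s = r div n2e D + 1; i = r mod n2e D in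
     Re (\<Sum>p<K D. of_real (theta D s) * harm_coeff D v i p
                    * exp (\<i> * of_int (harm D p) * of_real (omega0 D * emt_time D s)))))"

subsection \<open>Iteration and error operator\<close>

text \<open>A state is a pair of the TS solution and the stacked EMT solutions.\<close>

type_synonym state = "real vec \<times> real vec"

definition states :: "'w ras_data \<Rightarrow> state set" where
  "states D = carrier_vec (2 * K D * n1 D) \<times> carrier_vec (m D * n2 D)"

definition ras_step :: "'w :: linorder ras_data \<Rightarrow> state \<Rightarrow> state" where
  "ras_step D = (\<lambda>(u1, u2).
     (mat_inv (A1 D) *\<^sub>v (b1 D - E1 D *\<^sub>v Z1e D u2),
      mat_inv (H2 D) *\<^sub>v (E2stack D *\<^sub>v ts_to_emt D (R2e D *\<^sub>v u1) + g2 D)))"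

definition ras_fixed_point :: "'w :: linorder ras_data \<Rightarrow> state \<Rightarrow> bool" where
  "ras_fixed_point D x \<longleftrightarrow> x \<in> states D \<and> ras_step D x = x"

definition interface :: "'w :: linorder ras_data \<Rightarrow> state \<Rightarrow> real vec" where
  "interface D = (\<lambda>(u1, u2). RGamma D *\<^sub>v (u1 @\<^sub>v u2))"

definition P :: "'w :: linorder ras_data \<Rightarrow> real mat" where
  "P D = four_block_mat
     (0\<^sub>m (2 * K D * n1 D) (2 * K D * n1 D))
     (- (mat_inv (A1 D) * E1 D * Rhist0T D * (1\<^sub>m (m D) \<otimes>\<^sub>K R1e D)))
     (mat_inv (H2 D) * E2stack D * T_lin D * R2e D)
     (0\<^sub>m (m D * n2 D) (m D * n2 D))"

definition PGamma :: "'w :: linorder ras_data \<Rightarrow> real mat" where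
  "PGamma D = RGamma D * P D * transpose_mat (RGamma D)"

end

theory Submission
  imports Defs
begin

text \<open>
  One iteration reads its argument only through the interface: on stacked states it is the affine
  map \<open>x \<mapsto> c + Q (R x)\<close>, where \<open>R\<close> is the interface restriction. Hence \<open>P = Q R\<close>, and since the rows
  of \<open>R\<close> are orthonormal, \<open>R P R\<^sup>T = R Q\<close>. A state \<open>x\<close> is a fixed point iff \<open>x = c + Q y\<close> with
  \<open>y = R x\<close> solving \<open>(I - R Q) y = R c\<close>. Two consecutive iterates reveal the right-hand side, because
  \<open>R x\<^sub>k - (R Q) (R x\<^sub>k\<^sub>-\<^sub>1) = R c\<close>.
\<close>

section \<open>Vector arithmetic and matrix inverses\<close>

lemma mult_mat_vec_in_carrier: "A \<in> carrier_mat nr nc \<Longrightarrow> A *\<^sub>v v \<in> carrier_vec nr"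
  by (auto intro: carrier_vecI)

lemma zero_mat_mult_vec:
  "v \<in> carrier_vec nc \<Longrightarrow> 0\<^sub>m nr nc *\<^sub>v v = (0\<^sub>v nr :: 'a :: semiring_0 vec)"
  by (auto simp: vec_eq_iff)

lemma diff_add_eq_diff_diff_vec:
  fixes x y z :: "'a :: ab_group_add vec"
  assumes "x \<in> carrier_vec n" "y \<in> carrier_vec n" "z \<in> carrier_vec n"
  shows "x - (y + z) = x - y - z"
  using assms by (auto simp: vec_eq_iff algebra_simps)

lemma add_right_commute_vec:
  fixes x y z :: "'a :: ab_semigroup_add vec"
  assumes "x \<in> carrier_vec n" "y \<in> carrier_vec n" "z \<in> carrier_vec n"
  shows "x + y + z = x + z + y"
  using assms by (auto simp: vec_eq_iff ac_simps)

text \<open>As \<open>mat_inv\<close> is \<open>the\<close> of an option, the case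
  \<open>None\<close> has to be excluded: an invertible matrix is a unit of the matrix ring, and for
  units \<open>mat_inverse\<close> returns a result.\<close>

lemma mat_inv_inverts:
  assumes A: "A \<in> carrier_mat n n" and inv: "invertible_mat A"
  shows "mat_inv A \<in> carrier_mat n n" "mat_inv A * A = 1\<^sub>m n" "A * mat_inv A = 1\<^sub>m n"
proof -
  from inv obtain B where B: "A * B = 1\<^sub>m n" "B * A = 1\<^sub>m (dim_row B)"
    using A by (auto simp: invertible_mat_def inverts_mat_def)
  \<comment> \<open>The witness of \<open>invertible_mat\<close> comes without dimensions; counting
    the columns of both products forces it to be square of size \<open>n\<close>.\<close>
  have "dim_col B = n" "dim_row B = n"
    using arg_cong[OF B(1), of dim_col] arg_cong[OF B(2), of dim_col] A by auto
  then have "A \<in> Units (ring_mat TYPE('a) n ())"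
    using A B by (auto simp: Units_def ring_mat_def intro!: bexI[of _ B])
  then obtain C where C: "mat_inverse A = Some C"
    using mat_inverse(1)[OF A, where b = "()"] by (cases "mat_inverse A") auto
  then show "mat_inv A \<in> carrier_mat n n" "mat_inv A * A = 1\<^sub>m n" "A * mat_inv A = 1\<^sub>m n"
    using mat_inverse(2)[OF A C] by (auto simp: mat_inv_def)
qed

text \<open>A nonzero kernel vector of \<open>1 - A\<close> would be an eigenvector of
  \<open>A\<close> for the eigenvalue 1, so the determinant cannot vanish.\<close>

lemma invertible_one_minus_mat:
  fixes A :: "'a :: field mat"
  assumes A: "A \<in> carrier_mat n n" and ev: "\<not> eigenvalue A 1"
  shows "invertible_mat (1\<^sub>m n - A)"
proof -
  have M: "1\<^sub>m n - A \<in> carrier_mat n n" using A by auto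
  have "det (1\<^sub>m n - A) \<noteq> 0"
  proof
    assume "det (1\<^sub>m n - A) = 0"
    then obtain v where v: "v \<in> carrier_vec n" "v \<noteq> 0\<^sub>v n" "(1\<^sub>m n - A) *\<^sub>v v = 0\<^sub>v n"
      using det_0_iff_vec_prod_zero_field[OF M] by auto
    have "v - A *\<^sub>v v = 0\<^sub>v n"
      using v A by (simp add: minus_mult_distrib_mat_vec[of _ n n])
    then have "A *\<^sub>v v = v"
      using v(1) A by (auto simp: vec_eq_iff)
    then have "eigenvalue A 1"
      using v A by (auto simp: eigenvalue_def eigenvector_def intro!: exI[of _ v])
    with ev show False by simp
  qed
  from det_non_zero_imp_unit[OF M this, of "()"]
  obtain B where "B \<in> carrier_mat n n" "B * (1\<^sub>m n - A) = 1\<^sub>m n" "(1\<^sub>m n - A) * B = 1\<^sub>m n"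
    by (auto simp: Units_def ring_mat_def)
  then show ?thesis
    using A unfolding invertible_mat_def inverts_mat_def
    by (intro conjI exI[of _ B]) auto
qed

section \<open>Affine maps that read their argument only through a restriction\<close>

lemma restricted_affine_fixed_point:
  fixes Q R :: "'a :: field mat"
  assumes Q: "Q \<in> carrier_mat n g" and R: "R \<in> carrier_mat g n" and c: "c \<in> carrier_vec n"
    and inv: "invertible_mat (1\<^sub>m g - R * Q)" and x: "x \<in> carrier_vec n"
  shows "c + Q *\<^sub>v (R *\<^sub>v x) = x \<longleftrightarrow>
    x = c + Q *\<^sub>v (mat_inv (1\<^sub>m g - R * Q) *\<^sub>v (R *\<^sub>v c))" (is "_ \<longleftrightarrow> x = c + Q *\<^sub>v ?y")
    and "c + Q *\<^sub>v (R *\<^sub>v x) = x \<Longrightarrow> R *\<^sub>v x = mat_inv (1\<^sub>m g - R * Q) *\<^sub>v (R *\<^sub>v c)"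
proof -
  let ?M = "1\<^sub>m g - R * Q"
  have RQ: "R * Q \<in> carrier_mat g g" and M: "?M \<in> carrier_mat g g" using Q R by auto
  note N = mat_inv_inverts[OF M inv]
  have Rc: "R *\<^sub>v c \<in> carrier_vec g" using R c by auto
  have y: "?y \<in> carrier_vec g" using N(1) Rc by auto
  have split: "R *\<^sub>v (c + Q *\<^sub>v z) = R *\<^sub>v c + (R * Q) *\<^sub>v z" if "z \<in> carrier_vec g" for z
    using that Q R c by (simp add: mult_add_distrib_mat_vec[of _ g n] assoc_mult_mat_vec[of _ g n _ g])
  \<comment> \<open>The fixed-point equation closes up on the interface, where invertibility leaves
    \<open>?y\<close> as its only solution; both directions below rest on this.\<close>
  have iff: "z = R *\<^sub>v c + (R * Q) *\<^sub>v z \<longleftrightarrow> z = ?y" if z: "z \<in> carrier_vec g" for z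
  proof -
    \<comment> \<open>Removing \<open>index_mult_mat_vec\<close> keeps entries of matrix-vector
      products as atoms, so this is a componentwise rearrangement.\<close>
    have "z = R *\<^sub>v c + (R * Q) *\<^sub>v z \<longleftrightarrow> z - (R * Q) *\<^sub>v z = R *\<^sub>v c"
      using z RQ Rc by (auto simp: vec_eq_iff algebra_simps simp del: index_mult_mat_vec)
    also have "\<dots> \<longleftrightarrow> ?M *\<^sub>v z = R *\<^sub>v c"
      using z RQ by (simp add: minus_mult_distrib_mat_vec[of _ g g])
    also have "\<dots> \<longleftrightarrow> z = ?y"
      using assoc_mult_mat_vec[OF N(1) M z] assoc_mult_mat_vec[OF M N(1) Rc] z Rc
      by (auto simp only: N(2,3) one_mult_mat_vec)
    finally show ?thesis .
  qed
  show fix_imp: "R *\<^sub>v x = ?y" if "c + Q *\<^sub>v (R *\<^sub>v x) = x"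
  proof -
    have Rx: "R *\<^sub>v x \<in> carrier_vec g" using R x by auto
    have "R *\<^sub>v x = R *\<^sub>v (c + Q *\<^sub>v (R *\<^sub>v x))" by (simp only: that)
    also have "\<dots> = R *\<^sub>v c + (R * Q) *\<^sub>v (R *\<^sub>v x)" by (rule split[OF Rx])
    finally show ?thesis by (rule iff[OF Rx, THEN iffD1])
  qed
  show "c + Q *\<^sub>v (R *\<^sub>v x) = x \<longleftrightarrow> x = c + Q *\<^sub>v ?y"
  proof
    assume "c + Q *\<^sub>v (R *\<^sub>v x) = x"
    from fix_imp[OF this] this show "x = c + Q *\<^sub>v ?y" by (simp only:)
  next
    \<comment> \<open>Since \<open>?y\<close> solves the interface equation, it is the restriction
      of the state built from it; one more step therefore rebuilds the same state.\<close>
    assume xy: "x = c + Q *\<^sub>v ?y"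
    have "R *\<^sub>v x = ?y"
      unfolding xy split[OF y] by (rule iff[OF y, THEN iffD2, OF refl, symmetric])
    then show "c + Q *\<^sub>v (R *\<^sub>v x) = x" by (simp only: xy[symmetric])
  qed
qed

text \<open>Restricting a step with \<open>R\<close> turns its linear part into \<open>R * Q\<close>
  acting on the old interface values. The subtraction cancels exactly this part, wherever
  \<open>x\<close> lies, so no convergence is involved.\<close>

lemma restricted_affine_aitken:
  fixes Q R :: "'a :: field mat"
  assumes Q: "Q \<in> carrier_mat n g" and R: "R \<in> carrier_mat g n" and c: "c \<in> carrier_vec n"
    and x: "x \<in> carrier_vec n"
  shows "R *\<^sub>v (c + Q *\<^sub>v (R *\<^sub>v x)) - (R * Q) *\<^sub>v (R *\<^sub>v x) = R *\<^sub>v c"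
proof -
  have y: "R *\<^sub>v x \<in> carrier_vec g" using R x by auto
  have "R *\<^sub>v (c + Q *\<^sub>v (R *\<^sub>v x)) = R *\<^sub>v c + (R * Q) *\<^sub>v (R *\<^sub>v x)"
    using y Q R c by (simp add: mult_add_distrib_mat_vec[of _ g n] assoc_mult_mat_vec[of _ g n _ g])
  then show ?thesis
    using y Q R c by (auto simp: vec_eq_iff simp del: index_mult_mat_vec)
qed

section \<open>Matrices of linear maps\<close>

lemma mat_of_map_mult_vec:
  fixes f :: "'a :: field vec \<Rightarrow> 'a vec"
  assumes f: "\<And>v. v \<in> carrier_vec nc \<Longrightarrow> f v \<in> carrier_vec nr"
    and add: "\<And>v w. v \<in> carrier_vec nc \<Longrightarrow> w \<in> carrier_vec nc \<Longrightarrow> f (v + w) = f v + f w"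
    and smult: "\<And>a v. v \<in> carrier_vec nc \<Longrightarrow> f (a \<cdot>\<^sub>v v) = a \<cdot>\<^sub>v f v"
    and v: "v \<in> carrier_vec nc"
  shows "mat_of_map nr nc f *\<^sub>v v = f v"
proof -
  \<comment> \<open>\<open>mat_of_map\<close> samples \<open>f\<close> on unit vectors only. The
    truncations \<open>u k\<close> lead from the zero vector to \<open>v\<close> by adding one
    multiple of a unit vector at a time.\<close>
  define u where "u k = vec nc (\<lambda>i. if i < k then v $ i else 0)" for k
  have u: "u k \<in> carrier_vec nc" for k by (simp add: u_def)
  have "f (u k) $ i = (\<Sum>j<k. v $ j * f (unit_vec nc j) $ i)" if "k \<le> nc" and i: "i < nr" for k i
    using that(1)
  proof (induction k)
    case 0
    \<comment> \<open>The zero vector is 0 times itself, so homogeneity makes its image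
      vanish.\<close>
    have "u 0 = 0 \<cdot>\<^sub>v u 0" by (auto simp: u_def)
    then have "f (u 0) = 0 \<cdot>\<^sub>v f (u 0)" using smult[OF u] by metis
    then have "f (u 0) $ i = 0 * f (u 0) $ i"
      using f[OF u, of 0] i by (metis carrier_vecD index_smult_vec(1))
    then show ?case by simp
  next
    case (Suc k)
    have "u (Suc k) = u k + v $ k \<cdot>\<^sub>v unit_vec nc k"
      using Suc.prems by (auto simp: u_def vec_eq_iff less_Suc_eq)
    then have "f (u (Suc k)) = f (u k) + v $ k \<cdot>\<^sub>v f (unit_vec nc k)"
      using add[OF u, of "v $ k \<cdot>\<^sub>v unit_vec nc k" k] smult[of "unit_vec nc k" "v $ k"] by simp
    then show ?case
      using Suc f[OF u, of k] f[of "unit_vec nc k"] i by (simp add: carrier_vecD)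
  qed
  moreover have "u nc = v" using v by (auto simp: u_def)
  ultimately have fv: "f v $ i = (\<Sum>j<nc. v $ j * f (unit_vec nc j) $ i)" if "i < nr" for i
    using that by (metis order_refl)
  show ?thesis
    using f[OF v] v fv
    by (intro eq_vecI) (auto simp: mat_of_map_def scalar_prod_def lessThan_atLeast0 mult.commute
        carrier_vecD intro!: sum.cong)
qed

section \<open>Kronecker products and selection matrices\<close>

lemma sum_div_mod:
  fixes f :: "nat \<Rightarrow> nat \<Rightarrow> 'a :: comm_monoid_add"
  shows "(\<Sum>k<a * b. f (k div b) (k mod b)) = (\<Sum>i<a. \<Sum>j<b. f i j)"
proof -
  have "(\<Sum>i<a. \<Sum>j<b. f i j) = (\<Sum>(i, j)\<in>{..<a} \<times> {..<b}. f i j)"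
    by (simp add: sum.cartesian_product)
  also have "\<dots> = (\<Sum>k<a * b. f (k div b) (k mod b))"
  proof (rule sum.reindex_bij_witness[of _ "\<lambda>k. (k div b, k mod b)" "\<lambda>(i, j). i * b + j"])
    fix p assume "p \<in> {..<a} \<times> {..<b}"
    then obtain i j where p: "p = (i, j)" "i < a" "j < b" by auto
    have "i * b + j < Suc i * b" using p by simp
    also have "\<dots> \<le> a * b" using p by (intro mult_right_mono) auto
    finally show "(case p of (i, j) \<Rightarrow> i * b + j) \<in> {..<a * b}" using p by simp
  next
    fix k assume "k \<in> {..<a * b}"
    then have k: "k < a * b" by simp
    then have "0 < b" by (cases b) auto
    with k show "(k div b, k mod b) \<in> {..<a} \<times> {..<b}"
      by (simp add: less_mult_imp_div_less)
  qed auto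
  finally show ?thesis ..
qed

lemma kronecker_carrier [intro, simp]:
  "A \<in> carrier_mat r c \<Longrightarrow> B \<in> carrier_mat r' c' \<Longrightarrow> A \<otimes>\<^sub>K B \<in> carrier_mat (r * r') (c * c')"
  by (auto simp: kronecker_def)

lemma div_mod_less_of_less_mult:
  fixes i a b :: nat
  assumes "i < a * b"
  shows "i div b < a" "i mod b < b"
  using assms by (cases b; simp add: less_mult_imp_div_less)+

text \<open>The mixed-product rule: the inner summation index splits into quotient and remainder,
  and the double sum then factors. It reduces orthonormality of a Kronecker product to that of its
  factors.\<close>

lemma kronecker_mult:
  fixes A B C D :: "'a :: comm_semiring_0 mat"
  assumes A: "A \<in> carrier_mat ra n" and C: "C \<in> carrier_mat n ca"
    and B: "B \<in> carrier_mat rb k" and D: "D \<in> carrier_mat k cb"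
  shows "(A \<otimes>\<^sub>K B) * (C \<otimes>\<^sub>K D) = (A * C) \<otimes>\<^sub>K (B * D)"
proof (rule eq_matI)
  fix i j
  assume "i < dim_row ((A * C) \<otimes>\<^sub>K (B * D))" and "j < dim_col ((A * C) \<otimes>\<^sub>K (B * D))"
  then have i: "i < ra * rb" and j: "j < ca * cb" using assms by (auto simp: kronecker_def)
  note ij = div_mod_less_of_less_mult[OF i] div_mod_less_of_less_mult[OF j]
  have "((A \<otimes>\<^sub>K B) * (C \<otimes>\<^sub>K D)) $$ (i, j) =
    (\<Sum>l<n * k. (A $$ (i div rb, l div k) * B $$ (i mod rb, l mod k)) *
       (C $$ (l div k, j div cb) * D $$ (l mod k, j mod cb)))"
    using assms i j by (auto simp: kronecker_def scalar_prod_def lessThan_atLeast0)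
  also have "\<dots> = (\<Sum>p<n. \<Sum>q<k. (A $$ (i div rb, p) * B $$ (i mod rb, q)) *
       (C $$ (p, j div cb) * D $$ (q, j mod cb)))"
    by (rule sum_div_mod)
  also have "\<dots> = (\<Sum>p<n. A $$ (i div rb, p) * C $$ (p, j div cb)) *
      (\<Sum>q<k. B $$ (i mod rb, q) * D $$ (q, j mod cb))"
    by (simp add: sum_product mult_ac)
  also have "\<dots> = ((A * C) \<otimes>\<^sub>K (B * D)) $$ (i, j)"
    using assms i j ij by (auto simp: kronecker_def scalar_prod_def lessThan_atLeast0)
  finally show "((A \<otimes>\<^sub>K B) * (C \<otimes>\<^sub>K D)) $$ (i, j) = ((A * C) \<otimes>\<^sub>K (B * D)) $$ (i, j)" .
qed (use assms in \<open>auto simp: kronecker_def\<close>)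

lemma kronecker_transpose:
  "transpose_mat (A \<otimes>\<^sub>K B) = transpose_mat A \<otimes>\<^sub>K transpose_mat B"
  by (rule eq_matI) (auto simp: kronecker_def div_mod_less_of_less_mult)

lemma kronecker_one: "(1\<^sub>m a :: 'a :: semiring_1 mat) \<otimes>\<^sub>K 1\<^sub>m b = 1\<^sub>m (a * b)"
proof (rule eq_matI)
  fix i j assume "i < dim_row (1\<^sub>m (a * b) :: 'a mat)" "j < dim_col (1\<^sub>m (a * b) :: 'a mat)"
  then have ij: "i < a * b" "j < a * b" by auto
  have "i = j \<longleftrightarrow> i div b = j div b \<and> i mod b = j mod b"
    by (metis div_mult_mod_eq)
  then show "((1\<^sub>m a :: 'a mat) \<otimes>\<^sub>K 1\<^sub>m b) $$ (i, j) = 1\<^sub>m (a * b) $$ (i, j)"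
    using ij by (auto simp: kronecker_def div_mod_less_of_less_mult)
qed (auto simp: kronecker_def)

text \<open>Each entry of \<open>us\<close> occurs at exactly one position of \<open>vs\<close>, so
  every row is a standard basis vector; distinctness of \<open>us\<close> makes different rows
  orthogonal.\<close>

lemma selection_mult_transpose:
  assumes us: "distinct us" and vs: "distinct vs" and sub: "set us \<subseteq> set vs"
  shows "selection us vs * transpose_mat (selection us vs) = 1\<^sub>m (length us)"
proof (rule eq_matI)
  fix i j assume "i < dim_row (1\<^sub>m (length us) :: real mat)" "j < dim_col (1\<^sub>m (length us) :: real mat)"
  then have ij: "i < length us" "j < length us" by auto
  then obtain b where b: "b < length vs" "vs ! b = us ! i"
    using sub by (metis in_set_conv_nth nth_mem subsetD)
  have "(selection us vs * transpose_mat (selection us vs)) $$ (i, j) =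
      (\<Sum>k<length vs. (if us ! i = vs ! k then 1 else 0) * (if us ! j = vs ! k then 1 else 0))"
    using ij by (simp add: selection_def scalar_prod_def lessThan_atLeast0)
  also have "\<dots> = (\<Sum>k<length vs. if k = b then (if i = j then 1 else 0) else 0)"
    using b ij us vs by (intro sum.cong) (auto simp: nth_eq_iff_index_eq)
  also have "\<dots> = 1\<^sub>m (length us) $$ (i, j)"
    using b ij by simp
  finally show "(selection us vs * transpose_mat (selection us vs)) $$ (i, j) =
    1\<^sub>m (length us) $$ (i, j)" .
qed (auto simp: selection_def)

section \<open>The data of the affine form of one iteration\<close>

definition ts_to_emt_lin :: "'w ras_data \<Rightarrow> real vec \<Rightarrow> real vec" where
  "ts_to_emt_lin D v = vec (m D * n2e D) (\<lambda>r.
     let s = r div n2e D + 1; i = r mod n2e D in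
     Re (\<Sum>p<K D. of_real (theta D s) * harm_coeff D v i p
                    * exp (\<i> * of_int (harm D p) * of_real (omega0 D * emt_time D s))))"

text \<open>The matrix \<open>Q\<close> of the overview: \<open>P\<close> before composition with
  the restrictions, with columns indexed by interface values.\<close>

definition ras_update :: "'w :: linorder ras_data \<Rightarrow> real mat" where
  "ras_update D = four_block_mat
     (0\<^sub>m (2 * K D * n1 D) (2 * K D * n2e D)) (- (mat_inv (A1 D) * E1 D * Rhist0T D))
     (mat_inv (H2 D) * E2stack D * T_lin D) (0\<^sub>m (m D * n2 D) (m D * n1e D))"

text \<open>The constant \<open>c\<close> of the overview: the result of a step on zero interface
  values, where the converged history and \<open>vN\<close> still contribute.\<close>

definition ras_const :: "'w :: linorder ras_data \<Rightarrow> real vec" where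
  "ras_const D =
     (mat_inv (A1 D) *\<^sub>v (b1 D - E1 D *\<^sub>v (zhist D @\<^sub>v 0\<^sub>v (m D * n1e D)))) @\<^sub>v
     (mat_inv (H2 D) *\<^sub>v (E2stack D *\<^sub>v ts_to_emt D (0\<^sub>v (2 * K D * n2e D)) + g2 D))"

section \<open>Orthonormality of the interface restriction\<close>

context
  fixes D :: "'w :: linorder ras_data"
  assumes setting: "ras_setting D"
begin

text \<open>An exterior unknown lies in \<open>W D\<close> but outside its own subdomain, and the
  two subdomains cover \<open>W D\<close>. Hence the selections never look for a missing
  unknown.\<close>

lemma exterior_overlap: "W1e D \<subseteq> W2 D" "W2e D \<subseteq> W1 D"
  using setting by (auto simp: ras_setting_def W1e_def W2e_def exterior_def)

lemma finite_unknowns: "finite (W1 D)" "finite (W2 D)" "finite (W1e D)" "finite (W2e D)"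
proof -
  have "finite (W D)" "W1 D \<union> W2 D = W D" using setting by (auto simp: ras_setting_def)
  then show 1: "finite (W1 D)" "finite (W2 D)" by (metis finite_Un)+
  show "finite (W1e D)" "finite (W2e D)"
    using exterior_overlap 1 by (auto intro: finite_subset)
qed

lemma R1e_carrier: "R1e D \<in> carrier_mat (n1e D) (n2 D)"
  by (simp add: R1e_def selection_def n1e_def n2_def)

lemma R2e_carrier: "R2e D \<in> carrier_mat (2 * K D * n2e D) (2 * K D * n1 D)"
  using kronecker_carrier[of "selection (sorted_list_of_set (W2e D)) (sorted_list_of_set (W1 D))"
      "n2e D" "n1 D" "1\<^sub>m (2 * K D)" "2 * K D" "2 * K D"]
  by (simp add: R2e_def selection_def n2e_def n1_def mult.commute)

lemma R1e_stack_carrier: "1\<^sub>m (m D) \<otimes>\<^sub>K R1e D \<in> carrier_mat (m D * n1e D) (m D * n2 D)"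
  using R1e_carrier by auto

lemma RGamma_carrier: "RGamma D \<in> carrier_mat (nGamma D) (2 * K D * n1 D + m D * n2 D)"
  unfolding RGamma_def nGamma_def using R2e_carrier R1e_stack_carrier by auto

lemma R2e_mult_transpose: "R2e D * transpose_mat (R2e D) = 1\<^sub>m (2 * K D * n2e D)"
proof -
  let ?S = "selection (sorted_list_of_set (W2e D)) (sorted_list_of_set (W1 D))"
  have S: "?S \<in> carrier_mat (n2e D) (n1 D)" by (simp add: selection_def n2e_def n1_def)
  have "R2e D * transpose_mat (R2e D) = (?S * transpose_mat ?S) \<otimes>\<^sub>K (1\<^sub>m (2 * K D) * 1\<^sub>m (2 * K D))"
    unfolding R2e_def kronecker_transpose transpose_one by (rule kronecker_mult) (use S in auto)
  also have "?S * transpose_mat ?S = 1\<^sub>m (n2e D)"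
    using selection_mult_transpose[of "sorted_list_of_set (W2e D)" "sorted_list_of_set (W1 D)"]
      exterior_overlap finite_unknowns by (simp add: n2e_def)
  finally show ?thesis by (simp add: kronecker_one mult.commute)
qed

lemma R1e_stack_mult_transpose:
  "(1\<^sub>m (m D) \<otimes>\<^sub>K R1e D) * transpose_mat (1\<^sub>m (m D) \<otimes>\<^sub>K R1e D) = 1\<^sub>m (m D * n1e D)"
proof -
  have "(1\<^sub>m (m D) \<otimes>\<^sub>K R1e D) * transpose_mat (1\<^sub>m (m D) \<otimes>\<^sub>K R1e D) =
      (1\<^sub>m (m D) * 1\<^sub>m (m D)) \<otimes>\<^sub>K (R1e D * transpose_mat (R1e D))"
    unfolding kronecker_transpose transpose_one by (rule kronecker_mult) (use R1e_carrier in auto)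
  also have "R1e D * transpose_mat (R1e D) = 1\<^sub>m (n1e D)"
    using selection_mult_transpose[of "sorted_list_of_set (W1e D)" "sorted_list_of_set (W2 D)"]
      exterior_overlap finite_unknowns by (simp add: R1e_def n1e_def)
  finally show ?thesis by (simp add: kronecker_one)
qed

text \<open>The two diagonal blocks have orthonormal rows, and the zero blocks make the rows of one
  orthogonal to those of the other.\<close>

lemma RGamma_mult_transpose: "RGamma D * transpose_mat (RGamma D) = 1\<^sub>m (nGamma D)"
proof -
  let ?g1 = "2 * K D * n2e D" and ?g2 = "m D * n1e D" and ?s1 = "2 * K D * n1 D" and ?s2 = "m D * n2 D"
  let ?S = "1\<^sub>m (m D) \<otimes>\<^sub>K R1e D"
  note c = R2e_carrier R1e_stack_carrier
  have t: "transpose_mat (RGamma D) = four_block_mat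
      (transpose_mat (R2e D)) (0\<^sub>m ?s1 ?g2) (0\<^sub>m ?s2 ?g1) (transpose_mat ?S)"
    unfolding RGamma_def by (subst transpose_four_block_mat[of _ ?g1 ?s1 _ ?s2 _ ?g2]) (use c in auto)
  have "RGamma D * transpose_mat (RGamma D) = four_block_mat
      (R2e D * transpose_mat (R2e D) + 0\<^sub>m ?g1 ?s2 * 0\<^sub>m ?s2 ?g1)
      (R2e D * 0\<^sub>m ?s1 ?g2 + 0\<^sub>m ?g1 ?s2 * transpose_mat ?S)
      (0\<^sub>m ?g2 ?s1 * transpose_mat (R2e D) + ?S * 0\<^sub>m ?s2 ?g1)
      (0\<^sub>m ?g2 ?s1 * 0\<^sub>m ?s1 ?g2 + ?S * transpose_mat ?S)"
    unfolding t unfolding RGamma_def by (rule mult_four_block_mat) (use c in auto)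
  also have "\<dots> = 1\<^sub>m (nGamma D)"
    using c by (simp add: R2e_mult_transpose R1e_stack_mult_transpose nGamma_def)
  finally show ?thesis .
qed

section \<open>Dimensions, and the affine form of the translations\<close>

lemma T_emt_ts_carrier: "T_emt_ts D \<in> carrier_mat (2 * K D * n1e D) (mt D * n1e D)"
  by (simp add: T_emt_ts_def mat_of_map_def)

lemma T_lin_carrier: "T_lin D \<in> carrier_mat (m D * n2e D) (2 * K D * n2e D)"
  by (simp add: T_lin_def mat_of_map_def)

lemma ts_to_emt_carrier: "ts_to_emt D v \<in> carrier_vec (m D * n2e D)"
  by (simp add: ts_to_emt_def)

lemma E1_carrier: "E1 D \<in> carrier_mat (2 * K D * n1 D) (mt D * n1e D)"
  using setting T_emt_ts_carrier by (auto simp: E1_def ras_setting_def)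

lemma E2stack_carrier: "E2stack D \<in> carrier_mat (m D * n2 D) (m D * n2e D)"
  using setting by (auto simp: E2stack_def block_bidiag_def ras_setting_def)

lemma H2_carrier: "H2 D \<in> carrier_mat (m D * n2 D) (m D * n2 D)"
  using setting by (auto simp: H2_def block_bidiag_def ras_setting_def)

text \<open>\<open>m D <= mt D\<close> keeps the subtraction of naturals from truncating, so old and
  active blocks fill exactly one period.\<close>

lemma history_length: "(mt D - m D) * n1e D + m D * n1e D = mt D * n1e D"
  using setting by (simp add: ras_setting_def flip: add_mult_distrib)

lemma Rhist0T_carrier: "Rhist0T D \<in> carrier_mat (mt D * n1e D) (m D * n1e D)"
  using carrier_append_rows[of "0\<^sub>m ((mt D - m D) * n1e D) (m D * n1e D)" _ _ "1\<^sub>m (m D * n1e D)"]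
  by (simp add: Rhist0T_def flip: history_length)

text \<open>The larger of the two indices read by \<open>harm_coeff\<close>, that of the imaginary
  part, stays in range; entrywise rules for vectors apply only there.\<close>

lemma harm_coeff_index_less:
  assumes "i < n2e D" "p < K D"
  shows "2 * K D * i + 2 * p + 1 < 2 * K D * n2e D"
proof -
  have "2 * K D * i + 2 * p + 1 < 2 * K D * Suc i" using assms by simp
  also have "\<dots> \<le> 2 * K D * n2e D" using assms by (intro mult_left_mono) auto
  finally show ?thesis .
qed

lemma harm_coeff_linear:
  assumes "i < n2e D" "p < K D" "v \<in> carrier_vec (2 * K D * n2e D)" "w \<in> carrier_vec (2 * K D * n2e D)"
  shows "harm_coeff D (v + w) i p = harm_coeff D v i p + harm_coeff D w i p"
    and "harm_coeff D (a \<cdot>\<^sub>v v) i p = of_real a * harm_coeff D v i p"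
    and "harm_coeff D (0\<^sub>v (2 * K D * n2e D)) i p = 0"
  using harm_coeff_index_less[OF assms(1,2)] assms(3,4)
  by (auto simp: harm_coeff_def complex_eq_iff)

lemma T_lin_mult_vec:
  assumes v: "v \<in> carrier_vec (2 * K D * n2e D)"
  shows "T_lin D *\<^sub>v v = ts_to_emt_lin D v"
  \<comment> \<open>Folding the body exposes \<open>T_lin\<close> as \<open>mat_of_map\<close> of
    \<open>ts_to_emt_lin\<close>, so only additivity, homogeneity and the dimension remain.\<close>
  unfolding T_lin_def ts_to_emt_lin_def[symmetric]
proof (rule mat_of_map_mult_vec[OF _ _ _ v])
  fix v w :: "real vec"
  assume vw: "v \<in> carrier_vec (2 * K D * n2e D)" "w \<in> carrier_vec (2 * K D * n2e D)"
  show "ts_to_emt_lin D (v + w) = ts_to_emt_lin D v + ts_to_emt_lin D w"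
    using vw by (intro eq_vecI)
      (auto simp: ts_to_emt_lin_def Let_def harm_coeff_linear div_mod_less_of_less_mult
        distrib_left distrib_right sum.distrib simp del: Re_sum simp flip: plus_complex.sel)
next
  fix a :: real and v :: "real vec"
  assume v: "v \<in> carrier_vec (2 * K D * n2e D)"
  \<comment> \<open>A real factor commutes with \<open>Re\<close> once it is taken out of the
    complex sum; the phases \<open>e p\<close> may be arbitrary.\<close>
  have "Re (\<Sum>p<K D. of_real (theta D s) * harm_coeff D (a \<cdot>\<^sub>v v) i p * e p) =
       a * Re (\<Sum>p<K D. of_real (theta D s) * harm_coeff D v i p * e p)"
    if "i < n2e D" for i s e
  proof -
    have "(\<Sum>p<K D. of_real (theta D s) * harm_coeff D (a \<cdot>\<^sub>v v) i p * e p) =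
       of_real a * (\<Sum>p<K D. of_real (theta D s) * harm_coeff D v i p * e p)"
      using that v by (simp add: harm_coeff_linear(2)[OF _ _ v v] sum_distrib_left mult_ac)
    then show ?thesis by (simp only: Re_complex_of_real times_complex.sel) simp
  qed
  then show "ts_to_emt_lin D (a \<cdot>\<^sub>v v) = a \<cdot>\<^sub>v ts_to_emt_lin D v"
    by (intro eq_vecI)
      (auto simp: ts_to_emt_lin_def Let_def div_mod_less_of_less_mult simp del: Re_sum)
qed (simp add: ts_to_emt_lin_def)

text \<open>The \<open>vN\<close> term of the interpolation does not involve \<open>v\<close>, so it
  is the value at zero; the remaining term is linear.\<close>

lemma ts_to_emt_affine:
  assumes v: "v \<in> carrier_vec (2 * K D * n2e D)"
  shows "ts_to_emt D v = ts_to_emt D (0\<^sub>v (2 * K D * n2e D)) + T_lin D *\<^sub>v v"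
proof -
  let ?z = "0\<^sub>v (2 * K D * n2e D)"
  have "Re (\<Sum>p<K D. (of_real (1 - theta D s) * harm_coeff D (vN D) i p
                        + of_real (theta D s) * harm_coeff D v i p) * e p) =
      Re (\<Sum>p<K D. (of_real (1 - theta D s) * harm_coeff D (vN D) i p
                        + of_real (theta D s) * harm_coeff D ?z i p) * e p) +
      Re (\<Sum>p<K D. of_real (theta D s) * harm_coeff D v i p * e p)"
    if "i < n2e D" for i s e
    using that v by (simp add: harm_coeff_linear(3)[OF _ _ v v] distrib_right sum.distrib del: Re_sum)
  then show ?thesis
    unfolding T_lin_mult_vec[OF v]
    by (intro eq_vecI)
      (auto simp: ts_to_emt_def ts_to_emt_lin_def Let_def div_mod_less_of_less_mult
        simp del: Re_sum of_real_diff)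
qed

text \<open>Padding the converged and the active blocks with zeros turns concatenation into a sum;
  \<open>Rhist0T\<close> pads the active ones.\<close>

lemma Z1e_affine:
  assumes u: "u \<in> carrier_vec (m D * n2 D)"
  shows "Z1e D u = (zhist D @\<^sub>v 0\<^sub>v (m D * n1e D)) + Rhist0T D *\<^sub>v ((1\<^sub>m (m D) \<otimes>\<^sub>K R1e D) *\<^sub>v u)"
proof -
  let ?h = "(mt D - m D) * n1e D" and ?a = "m D * n1e D"
  let ?z = "(1\<^sub>m (m D) \<otimes>\<^sub>K R1e D) *\<^sub>v u"
  have z: "?z \<in> carrier_vec ?a" using R1e_stack_carrier u by auto
  have h: "zhist D \<in> carrier_vec ?h" using setting by (simp add: ras_setting_def)
  have "Rhist0T D *\<^sub>v ?z = 0\<^sub>v ?h @\<^sub>v ?z"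
    unfolding Rhist0T_def using mat_mult_append[of "0\<^sub>m ?h ?a" ?h ?a "1\<^sub>m ?a" ?a ?z] z
    by (simp add: zero_mat_mult_vec)
  then show ?thesis
    using append_vec_add[of "zhist D" ?h "0\<^sub>v ?h" "0\<^sub>v ?a" ?a ?z] z h by (simp add: Z1e_def)
qed

lemma RGamma_mult_append:
  assumes u: "u1 \<in> carrier_vec (2 * K D * n1 D)" "u2 \<in> carrier_vec (m D * n2 D)"
  shows "RGamma D *\<^sub>v (u1 @\<^sub>v u2) = (R2e D *\<^sub>v u1) @\<^sub>v ((1\<^sub>m (m D) \<otimes>\<^sub>K R1e D) *\<^sub>v u2)"
proof -
  let ?z1 = "R2e D *\<^sub>v u1" and ?z2 = "(1\<^sub>m (m D) \<otimes>\<^sub>K R1e D) *\<^sub>v u2"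
  have "?z1 \<in> carrier_vec (2 * K D * n2e D)" "?z2 \<in> carrier_vec (m D * n1e D)"
    using R2e_carrier R1e_stack_carrier u by auto
  then show ?thesis
    unfolding RGamma_def
    by (subst four_block_mat_mult_vec[OF R2e_carrier _ _ R1e_stack_carrier u])
      (use u in \<open>auto simp: zero_mat_mult_vec\<close>)
qed

section \<open>Factoring the step and the error operator through the interface\<close>

context
  assumes inv_A1: "invertible_mat (A1 D)" and inv_H2: "invertible_mat (H2 D)"
begin

lemma mat_inv_A1_carrier: "mat_inv (A1 D) \<in> carrier_mat (2 * K D * n1 D) (2 * K D * n1 D)"
  using setting inv_A1 by (intro mat_inv_inverts) (auto simp: ras_setting_def)

lemma mat_inv_H2_carrier: "mat_inv (H2 D) \<in> carrier_mat (m D * n2 D) (m D * n2 D)"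
  using H2_carrier inv_H2 by (rule mat_inv_inverts)

lemma TS_block_carrier:
  "mat_inv (A1 D) * E1 D * Rhist0T D \<in> carrier_mat (2 * K D * n1 D) (m D * n1e D)"
  using mat_inv_A1_carrier E1_carrier Rhist0T_carrier by auto

lemma EMT_block_carrier:
  "mat_inv (H2 D) * E2stack D * T_lin D \<in> carrier_mat (m D * n2 D) (2 * K D * n2e D)"
  using mat_inv_H2_carrier E2stack_carrier T_lin_carrier by auto

lemma ras_update_carrier:
  "ras_update D \<in> carrier_mat (2 * K D * n1 D + m D * n2 D) (nGamma D)"
  unfolding ras_update_def nGamma_def using TS_block_carrier EMT_block_carrier by auto

lemma ras_const_carrier: "ras_const D \<in> carrier_vec (2 * K D * n1 D + m D * n2 D)"
  unfolding ras_const_def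
  by (intro append_carrier_vec mult_mat_vec_in_carrier[OF mat_inv_A1_carrier]
      mult_mat_vec_in_carrier[OF mat_inv_H2_carrier])

text \<open>Each nonzero block of \<open>P\<close> ends in a restriction, and these two restrictions
  are the diagonal blocks of \<open>RGamma\<close>.\<close>

lemma P_eq: "P D = ras_update D * RGamma D"
proof -
  let ?g1 = "2 * K D * n2e D" and ?g2 = "m D * n1e D" and ?s1 = "2 * K D * n1 D" and ?s2 = "m D * n2 D"
  let ?S = "1\<^sub>m (m D) \<otimes>\<^sub>K R1e D"
  let ?B = "mat_inv (A1 D) * E1 D * Rhist0T D" and ?C = "mat_inv (H2 D) * E2stack D * T_lin D"
  note c = R2e_carrier R1e_stack_carrier TS_block_carrier EMT_block_carrier
  have "ras_update D * RGamma D = four_block_mat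
      (0\<^sub>m ?s1 ?g1 * R2e D + - ?B * 0\<^sub>m ?g2 ?s1) (0\<^sub>m ?s1 ?g1 * 0\<^sub>m ?g1 ?s2 + - ?B * ?S)
      (?C * R2e D + 0\<^sub>m ?s2 ?g2 * 0\<^sub>m ?g2 ?s1) (?C * 0\<^sub>m ?g1 ?s2 + 0\<^sub>m ?s2 ?g2 * ?S)"
    unfolding ras_update_def RGamma_def by (rule mult_four_block_mat) (use c in auto)
  moreover have "- ?B * ?S = - (?B * ?S)"
    using c by (intro uminus_mult_left_mat) auto
  moreover have "- ?B \<in> carrier_mat ?s1 ?g2" "?B * ?S \<in> carrier_mat ?s1 ?s2" "?C * R2e D \<in> carrier_mat ?s2 ?s1"
    using c by auto
  ultimately show ?thesis
    using c by (simp add: P_def right_mult_zero_mat[of _ ?s1 ?g2] right_mult_zero_mat[of _ ?s2 ?g1])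
qed

text \<open>This carries the eigenvalue hypothesis over to the matrix \<open>R * Q\<close> of the
  lemmas on restricted affine maps.\<close>

lemma PGamma_eq: "PGamma D = RGamma D * ras_update D"
proof -
  let ?R = "RGamma D" and ?Q = "ras_update D"
  let ?n = "2 * K D * n1 D + m D * n2 D" and ?g = "nGamma D"
  note c = RGamma_carrier ras_update_carrier
  have Rt: "transpose_mat ?R \<in> carrier_mat ?n ?g" using c by auto
  have "PGamma D = (?R * ?Q) * (?R * transpose_mat ?R)"
    unfolding PGamma_def P_eq assoc_mult_mat[OF c c(1), symmetric]
    by (rule assoc_mult_mat[OF mult_carrier_mat[OF c] c(1) Rt])
  then show ?thesis
    using c by (simp add: RGamma_mult_transpose)
qed

text \<open>Expanding both translations in affine form collects the fixed data in
  \<open>ras_const\<close>; the iterate survives only behind the two restrictions.\<close>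

lemma ras_step_affine:
  assumes u: "u1 \<in> carrier_vec (2 * K D * n1 D)" "u2 \<in> carrier_vec (m D * n2 D)"
  shows "fst (ras_step D (u1, u2)) @\<^sub>v snd (ras_step D (u1, u2)) =
    ras_const D + ras_update D *\<^sub>v (RGamma D *\<^sub>v (u1 @\<^sub>v u2))"
proof -
  let ?g1 = "2 * K D * n2e D" and ?g2 = "m D * n1e D" and ?s1 = "2 * K D * n1 D" and ?s2 = "m D * n2 D"
  let ?z1 = "R2e D *\<^sub>v u1" and ?z2 = "(1\<^sub>m (m D) \<otimes>\<^sub>K R1e D) *\<^sub>v u2"
  let ?Ai = "mat_inv (A1 D)" and ?Hi = "mat_inv (H2 D)"
  let ?z0 = "zhist D @\<^sub>v 0\<^sub>v ?g2" and ?t0 = "ts_to_emt D (0\<^sub>v ?g1)"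
  have z: "?z1 \<in> carrier_vec ?g1" "?z2 \<in> carrier_vec ?g2"
    using R2e_carrier R1e_stack_carrier u by auto
  have b: "b1 D \<in> carrier_vec ?s1" "g2 D \<in> carrier_vec ?s2"
    "zhist D \<in> carrier_vec ((mt D - m D) * n1e D)"
    using setting by (auto simp: ras_setting_def)
  then have z0: "?z0 \<in> carrier_vec (mt D * n1e D)"
    by (metis append_carrier_vec history_length zero_carrier_vec)
  note c = mat_inv_A1_carrier mat_inv_H2_carrier E1_carrier E2stack_carrier Rhist0T_carrier
    T_lin_carrier ts_to_emt_carrier[of "0\<^sub>v ?g1"]
  have Rz: "Rhist0T D *\<^sub>v ?z2 \<in> carrier_vec (mt D * n1e D)" using c z by auto
  have Tz: "T_lin D *\<^sub>v ?z1 \<in> carrier_vec (m D * n2e D)" using c z by auto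
  have E0: "E1 D *\<^sub>v ?z0 \<in> carrier_vec ?s1" and ER: "E1 D *\<^sub>v (Rhist0T D *\<^sub>v ?z2) \<in> carrier_vec ?s1"
    using c z0 Rz by auto
  have Et: "E2stack D *\<^sub>v ?t0 \<in> carrier_vec ?s2" and ET: "E2stack D *\<^sub>v (T_lin D *\<^sub>v ?z1) \<in> carrier_vec ?s2"
    using c Tz by auto
  have "b1 D - E1 D *\<^sub>v Z1e D u2 = (b1 D - E1 D *\<^sub>v ?z0) - E1 D *\<^sub>v (Rhist0T D *\<^sub>v ?z2)"
    unfolding Z1e_affine[OF u(2)] mult_add_distrib_mat_vec[OF E1_carrier z0 Rz]
    using b E0 ER by (intro diff_add_eq_diff_diff_vec)
  then have 1: "fst (ras_step D (u1, u2)) =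
      ?Ai *\<^sub>v (b1 D - E1 D *\<^sub>v ?z0) - ?Ai *\<^sub>v (E1 D *\<^sub>v (Rhist0T D *\<^sub>v ?z2))"
    using b E0 ER c(1) by (simp add: ras_step_def mult_minus_distrib_mat_vec[of _ ?s1 ?s1])
  \<comment> \<open>The step applies its matrices one after another, while the block of
    \<open>ras_update\<close> is their product.\<close>
  have A: "?Ai *\<^sub>v (E1 D *\<^sub>v (Rhist0T D *\<^sub>v ?z2)) = (?Ai * E1 D * Rhist0T D) *\<^sub>v ?z2"
    using assoc_mult_mat_vec[OF mult_carrier_mat[OF c(1,3)] c(5) z(2)]
      assoc_mult_mat_vec[OF c(1,3) Rz] by simp
  then have 2: "- (?Ai * E1 D * Rhist0T D) *\<^sub>v ?z2 = - (?Ai *\<^sub>v (E1 D *\<^sub>v (Rhist0T D *\<^sub>v ?z2)))"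
    unfolding A by (intro uminus_mult_mat_vec) (use Rhist0T_carrier R1e_stack_carrier in auto)
  have "E2stack D *\<^sub>v ts_to_emt D ?z1 + g2 D = (E2stack D *\<^sub>v ?t0 + g2 D) + E2stack D *\<^sub>v (T_lin D *\<^sub>v ?z1)"
    unfolding ts_to_emt_affine[OF z(1)] mult_add_distrib_mat_vec[OF E2stack_carrier c(7) Tz]
    using b Et ET by (intro add_right_commute_vec)
  then have 3: "snd (ras_step D (u1, u2)) =
      ?Hi *\<^sub>v (E2stack D *\<^sub>v ?t0 + g2 D) + ?Hi *\<^sub>v (E2stack D *\<^sub>v (T_lin D *\<^sub>v ?z1))"
    using mult_add_distrib_mat_vec[OF c(2) add_carrier_vec[OF Et b(2)] ET] by (simp add: ras_step_def)
  have 4: "(?Hi * E2stack D * T_lin D) *\<^sub>v ?z1 = ?Hi *\<^sub>v (E2stack D *\<^sub>v (T_lin D *\<^sub>v ?z1))"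
    using assoc_mult_mat_vec[OF mult_carrier_mat[OF c(2,4)] c(6) z(1)]
      assoc_mult_mat_vec[OF c(2,4) Tz] by simp
  \<comment> \<open>The zero diagonal blocks express the crossing: the TS component reads only EMT
    interface values, and conversely.\<close>
  have "ras_update D *\<^sub>v (?z1 @\<^sub>v ?z2) =
      (0\<^sub>m ?s1 ?g1 *\<^sub>v ?z1 + - (?Ai * E1 D * Rhist0T D) *\<^sub>v ?z2) @\<^sub>v
      ((?Hi * E2stack D * T_lin D) *\<^sub>v ?z1 + 0\<^sub>m ?s2 ?g2 *\<^sub>v ?z2)"
    unfolding ras_update_def
    by (rule four_block_mat_mult_vec) (use z TS_block_carrier EMT_block_carrier in auto)
  also have "\<dots> = (- (?Ai *\<^sub>v (E1 D *\<^sub>v (Rhist0T D *\<^sub>v ?z2)))) @\<^sub>v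
      (?Hi *\<^sub>v (E2stack D *\<^sub>v (T_lin D *\<^sub>v ?z1)))"
    unfolding 2 4 using z c ER ET by (simp add: zero_mat_mult_vec)
  finally have "ras_const D + ras_update D *\<^sub>v (?z1 @\<^sub>v ?z2) =
      (?Ai *\<^sub>v (b1 D - E1 D *\<^sub>v ?z0) + - (?Ai *\<^sub>v (E1 D *\<^sub>v (Rhist0T D *\<^sub>v ?z2)))) @\<^sub>v
      (?Hi *\<^sub>v (E2stack D *\<^sub>v ?t0 + g2 D) + ?Hi *\<^sub>v (E2stack D *\<^sub>v (T_lin D *\<^sub>v ?z1)))"
    unfolding ras_const_def
    by (simp only:) (rule append_vec_add[of _ ?s1 _ _ ?s2], use c b E0 ER Et ET in auto)
  also have "?Ai *\<^sub>v (b1 D - E1 D *\<^sub>v ?z0) + - (?Ai *\<^sub>v (E1 D *\<^sub>v (Rhist0T D *\<^sub>v ?z2))) =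
      fst (ras_step D (u1, u2))"
    unfolding 1 by (rule minus_add_uminus_vec[symmetric, of _ ?s1]) (use c b E0 ER in auto)
  finally show ?thesis
    unfolding RGamma_mult_append[OF u] 3 by simp
qed

lemma ras_step_states:
  assumes "u \<in> states D"
  shows "ras_step D u \<in> states D"
  using assms mat_inv_A1_carrier mat_inv_H2_carrier
  by (auto simp: states_def ras_step_def intro: mult_mat_vec_in_carrier)

end

end

text \<open>The invertibility conjunct gives \<open>mat_inv\<close> its meaning, and existence of a
  fixed point keeps the final quantified formula from being vacuous.\<close>

theorem proposition3:
  fixes D :: "'w :: linorder ras_data" and x :: "nat \<Rightarrow> state"
  assumes "ras_setting D"
    and "invertible_mat (A1 D)" and "invertible_mat (H2 D)"
    and "x 0 \<in> states D"
    and "\<And>k. x (Suc k) = ras_step D (x k)"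
    and "\<not> eigenvalue (PGamma D) 1"
  shows "invertible_mat (1\<^sub>m (nGamma D) - PGamma D) \<and>
    (\<exists>!xinf. ras_fixed_point D xinf) \<and>
    (\<forall>xinf k. ras_fixed_point D xinf \<longrightarrow> k \<ge> 1 \<longrightarrow>
       interface D xinf =
         mat_inv (1\<^sub>m (nGamma D) - PGamma D) *\<^sub>v
           (interface D (x k) - PGamma D *\<^sub>v interface D (x (k - 1))))"
proof -
  let ?s1 = "2 * K D * n1 D" and ?s2 = "m D * n2 D" and ?g = "nGamma D"
  let ?n = "?s1 + ?s2"
  let ?R = "RGamma D" and ?Q = "ras_update D" and ?c = "ras_const D"
  let ?N = "mat_inv (1\<^sub>m ?g - ?R * ?Q)"
  note R = RGamma_carrier[OF assms(1)]
  note Q = ras_update_carrier[OF assms(1-3)]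
  note c = ras_const_carrier[OF assms(1-3)]
  note PG = PGamma_eq[OF assms(1-3)]
  define cat :: "state \<Rightarrow> real vec" where "cat u = fst u @\<^sub>v snd u" for u
  have cat: "cat u \<in> carrier_vec ?n" if "u \<in> states D" for u
    using that by (auto simp: cat_def states_def)
  \<comment> \<open>The first components of two states have equal length, so stacking loses
    nothing.\<close>
  have cat_inj: "u = v" if "u \<in> states D" "v \<in> states D" "cat u = cat v" for u v
    using that by (auto simp: cat_def states_def prod_eq_iff append_vec_eq[of _ ?s1])
  have interface: "interface D u = ?R *\<^sub>v cat u" for u
    by (simp add: interface_def cat_def case_prod_beta)
  have step: "cat (ras_step D u) = ?c + ?Q *\<^sub>v (?R *\<^sub>v cat u)" if "u \<in> states D" for u
    using ras_step_affine[OF assms(1-3), of "fst u" "snd u"] that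
    by (auto simp: cat_def states_def)
  have "PGamma D \<in> carrier_mat ?g ?g" unfolding PG using R Q by auto
  then have inv: "invertible_mat (1\<^sub>m ?g - ?R * ?Q)"
    using invertible_one_minus_mat assms(6) PG by metis
  note fixed = restricted_affine_fixed_point[OF Q R c inv]
  \<comment> \<open>A step maps states to states, so injectivity of \<open>cat\<close> turns the
    equation of stacked vectors back into one of pairs.\<close>
  have fp: "ras_fixed_point D u \<longleftrightarrow> u \<in> states D \<and> ?c + ?Q *\<^sub>v (?R *\<^sub>v cat u) = cat u" for u
    unfolding ras_fixed_point_def
    by (metis cat_inj ras_step_states[OF assms(1-3)] step)
  have x: "x k \<in> states D" for k
    by (induction k) (use assms(4,5) ras_step_states[OF assms(1-3)] in auto)
  have "\<exists>!u. ras_fixed_point D u"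
  proof (rule ex_ex1I)
    \<comment> \<open>The solution formula for stacked vectors, cut below into its TS and EMT
      parts.\<close>
    let ?w = "?c + ?Q *\<^sub>v (?N *\<^sub>v (?R *\<^sub>v ?c))"
    have w: "?w \<in> carrier_vec ?n" using c Q by (intro add_carrier_vec mult_mat_vec_in_carrier)
    let ?u = "(vec_first ?w ?s1, vec_last ?w ?s2)"
    have "?u \<in> states D" by (simp add: states_def)
    moreover have "cat ?u = ?w" using w by (simp add: cat_def)
    ultimately have "ras_fixed_point D ?u"
      using fp fixed(1)[OF w] by metis
    then show "\<exists>u. ras_fixed_point D u" ..
  next
    fix u v assume "ras_fixed_point D u" "ras_fixed_point D v"
    \<comment> \<open>The right-hand side of \<open>fixed(1)\<close> does not mention the state, so
      both fixed points have the same stacked vector.\<close>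
    then show "u = v" using fp fixed(1) cat cat_inj by metis
  qed
  moreover have "interface D u = mat_inv (1\<^sub>m ?g - PGamma D) *\<^sub>v
      (interface D (x k) - PGamma D *\<^sub>v interface D (x (k - 1)))"
    if u: "ras_fixed_point D u" and k: "k \<ge> 1" for u k
  proof -
    \<comment> \<open>\<open>k >= 1\<close> makes \<open>k - 1\<close> a true predecessor, since
      \<open>0 - 1 = 0\<close> on naturals.\<close>
    have "x k = ras_step D (x (k - 1))" using k assms(5)[of "k - 1"] by simp
    then have "interface D (x k) - PGamma D *\<^sub>v interface D (x (k - 1)) = ?R *\<^sub>v ?c"
      using restricted_affine_aitken[OF Q R c cat[OF x]] step[OF x] by (simp add: interface PG)
    moreover have "interface D u = ?N *\<^sub>v (?R *\<^sub>v ?c)"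
      using fp fixed(2) cat u by (metis interface)
    ultimately show ?thesis by (simp add: PG)
  qed
  ultimately show ?thesis using inv PG by simp
qed

end
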